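(* Let $(X,d)$ be a relatively compact metric space and let $(f,g)$ be a paired system on $X$. Suppose that $(f,g)$ has the paired shadowing property and that $f$ is expansive with expansivity constant $\mathfrak{c}$. Then: (1) $(f,g)$ is paired topologically stable. (2) If, in addition, $(f,g)$ is commutative, then $(f,g)$ is $c$-paired topologically stable. (3) For each $0<\epsilon<\frac{\mathfrak{c}}{3}$ there exists $\delta>0$ such that for each $h\in UE^{\delta}_{(f,g)}(X)$ there exists a unique continuous map $k:X\to X$ satisfying $f\circ k=k\circ g\circ h$ and $d(k(x),x)\le\epsilon$ for each $x\in X$. In addition, if $h$ is expansive with expansivity constant $\mathfrak{c}'\ge 3\epsilon$, then $k$ is injective on the set of fixed points of $g$, i.e. the restriction $k|_{Fix(g)}:Fix(g)\to X$ is injective, where $Fix(g)=\{x\in X\mid g(x)=x\}$.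
   Context: A uniform equivalence of a metric space $(X,d)$ is a bijection $f:X\to X$ such that both $f$ and $f^{-1}$ are uniformly continuous. A paired system $(f,g)$ on $X$ is a pair of uniform equivalences $f,g:X\to X$; it is commutative if $f\circ g=g\circ f$. A metric space $X$ is called relatively compact if every bounded subset of $X$ is contained in a compact set; equivalently, every closed ball of finite radius in $X$ is compact. A self-homeomorphism $f$ of $(X,d)$ is expansive with expansivity constant $\mathfrak{c}>0$ if for every pair of distinct points $x,y\in X$ there exists $n\in\mathbb{Z}$ with $d(f^n(x),f^n(y))>\mathfrak{c}$. Paired shadowing property (PSP): a sequence $\{x_n\}_{n\in\mathbb{Z}}$ in $X$ is a $\delta$-pseudo orbit of $(f,g)$ if $d(f(x_n),g(x_{n+1}))\le\delta$ for each $n\in\mathbb{Z}$. It is $\epsilon$-traced (through $(f,g)$) by $x\in X$ if $d(f^n(x),g^n(x_n))\le\epsilon$ for each $n\in\mathbb{Z}$. The system $(f,g)$ has PSP if for each $\epsilon>0$ there exists $\delta>0$ such that each $\delta$-pseudo orbit of $(f,g)$ can be $\epsilon$-traced by some point of $X$. Let $\overline{d}(x,y)=\min\{d(x,y),1\}$ for $x,y\in X$, and for homeomorphisms $f,f'$ of $X$ let $\overline{d}(f,f')=\sup_{x\in X}\overline{d}(f(x),f'(x))$. For $\delta>0$, $UE^{\delta}_{(f,g)}(X)$ is the set of all $h:X\to X$ such that $(h,g)$ is a commutative paired system on $X$ (i.e. $h$ is a uniform equivalence commuting with $g$) and $\overline{d}(f,g\circ h)<\delta$. A paired system $(f,g)$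 on $X$ is paired topologically stable if for each $\epsilon>0$ there exists $\delta>0$ such that for each $h\in UE^{\delta}_{(f,g)}(X)$ there exists a continuous map $k:X\to X$ such that $f\circ k=k\circ g\circ h$ and $d(k(x),x)<\epsilon$ for each $x\in X$. If additionally $k$ can be taken with $g\circ k=k\circ g$, then $(f,g)$ is called $c$-paired topologically stable. When dealing with paired topological stability, the constants $\mathfrak{c},\mathfrak{c}',\epsilon,\delta$ may be assumed to lie in $(0,1)$. *)

theory Defs
  imports "HOL-Analysis.Analysis"
begin

text \<open>The metric space $X$ is the type \<open>'a::metric_space\<close>.\<close>

text \<open>The integer iterate $f^n$; it is only meaningful for a bijection \<open>f\<close>.\<close>

definition int_iterate :: "('a \<Rightarrow> 'a) \<Rightarrow> int \<Rightarrow> 'a \<Rightarrow> 'a" where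
  "int_iterate f n = (if n \<ge> 0 then f ^^ nat n else inv f ^^ nat (- n))"

definition relatively_compact_space :: "'a::metric_space itself \<Rightarrow> bool" where
  "relatively_compact_space _ \<longleftrightarrow> (\<forall>B :: 'a set. bounded B \<longrightarrow> (\<exists>C. compact C \<and> B \<subseteq> C))"

definition uniform_equivalence :: "('a::metric_space \<Rightarrow> 'a) \<Rightarrow> bool" where
  "uniform_equivalence f \<longleftrightarrow>
     bij f \<and> uniformly_continuous_on UNIV f \<and> uniformly_continuous_on UNIV (inv f)"

definition paired_system :: "('a::metric_space \<Rightarrow> 'a) \<Rightarrow> ('a \<Rightarrow> 'a) \<Rightarrow> bool" where
  "paired_system f g \<longleftrightarrow> uniform_equivalence f \<and> uniform_equivalence g"

definition commutative_paired_system :: "('a::metric_space \<Rightarrow> 'a) \<Rightarrow> ('a \<Rightarrow> 'a) \<Rightarrow> bool" where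
  "commutative_paired_system f g \<longleftrightarrow> paired_system f g \<and> f \<circ> g = g \<circ> f"

definition expansive_with :: "('a::metric_space \<Rightarrow> 'a) \<Rightarrow> real \<Rightarrow> bool" where
  "expansive_with f c \<longleftrightarrow>
     homeomorphism UNIV UNIV f (inv f) \<and> c > 0 \<and>
     (\<forall>x y. x \<noteq> y \<longrightarrow> (\<exists>n. dist (int_iterate f n x) (int_iterate f n y) > c))"

definition paired_pseudo_orbit ::
    "('a::metric_space \<Rightarrow> 'a) \<Rightarrow> ('a \<Rightarrow> 'a) \<Rightarrow> real \<Rightarrow> (int \<Rightarrow> 'a) \<Rightarrow> bool" where
  "paired_pseudo_orbit f g \<delta> xs \<longleftrightarrow> (\<forall>n. dist (f (xs n)) (g (xs (n + 1))) \<le> \<delta>)"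

definition paired_traced ::
    "('a::metric_space \<Rightarrow> 'a) \<Rightarrow> ('a \<Rightarrow> 'a) \<Rightarrow> real \<Rightarrow> (int \<Rightarrow> 'a) \<Rightarrow> 'a \<Rightarrow> bool" where
  "paired_traced f g \<epsilon> xs x \<longleftrightarrow> (\<forall>n. dist (int_iterate f n x) (int_iterate g n (xs n)) \<le> \<epsilon>)"

definition paired_shadowing_property :: "('a::metric_space \<Rightarrow> 'a) \<Rightarrow> ('a \<Rightarrow> 'a) \<Rightarrow> bool" where
  "paired_shadowing_property f g \<longleftrightarrow>
     (\<forall>\<epsilon>>0. \<exists>\<delta>>0. \<forall>xs. paired_pseudo_orbit f g \<delta> xs \<longrightarrow> (\<exists>x. paired_traced f g \<epsilon> xs x))"

text \<open>The truncation at \<open>1\<close> bounds the set, so the real supremum is the true one.\<close>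

definition dist_bar :: "('a::metric_space \<Rightarrow> 'a) \<Rightarrow> ('a \<Rightarrow> 'a) \<Rightarrow> real" where
  "dist_bar f f' = (SUP x. min (dist (f x) (f' x)) 1)"

definition UE :: "real \<Rightarrow> ('a::metric_space \<Rightarrow> 'a) \<Rightarrow> ('a \<Rightarrow> 'a) \<Rightarrow> ('a \<Rightarrow> 'a) set" where
  "UE \<delta> f g = {h. commutative_paired_system h g \<and> dist_bar f (g \<circ> h) < \<delta>}"

definition paired_topologically_stable :: "('a::metric_space \<Rightarrow> 'a) \<Rightarrow> ('a \<Rightarrow> 'a) \<Rightarrow> bool" where
  "paired_topologically_stable f g \<longleftrightarrow>
     (\<forall>\<epsilon>>0. \<exists>\<delta>>0. \<forall>h \<in> UE \<delta> f g. \<exists>k.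
        continuous_on UNIV k \<and> f \<circ> k = k \<circ> g \<circ> h \<and> (\<forall>x. dist (k x) x < \<epsilon>))"

definition c_paired_topologically_stable :: "('a::metric_space \<Rightarrow> 'a) \<Rightarrow> ('a \<Rightarrow> 'a) \<Rightarrow> bool" where
  "c_paired_topologically_stable f g \<longleftrightarrow>
     (\<forall>\<epsilon>>0. \<exists>\<delta>>0. \<forall>h \<in> UE \<delta> f g. \<exists>k.
        continuous_on UNIV k \<and> f \<circ> k = k \<circ> g \<circ> h \<and> (\<forall>x. dist (k x) x < \<epsilon>) \<and>
        g \<circ> k = k \<circ> g)"

end

theory Submission imports Defs begin

text \<open>
  Let \<open>h\<close> commute with \<open>g\<close> and put \<open>T = g \<circ> h\<close>, so that \<open>T\<^sup>n = g\<^sup>n h\<^sup>n\<close>. If \<open>T\<close> is uniformly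
  \<open>\<delta>\<close>-close to \<open>f\<close>, then for every \<open>x\<close> the sequence \<open>h\<^sup>n x\<close> is a paired \<open>\<delta>\<close>-pseudo orbit, and a
  point \<open>z\<close> traces it precisely when the genuine \<open>f\<close>-orbit of \<open>z\<close> stays \<open>\<epsilon>\<close>-close to the genuine
  \<open>T\<close>-orbit of \<open>x\<close>. The paired problem thereby becomes one about two single homeomorphisms, \<open>f\<close>
  and \<open>T\<close>, and the paired shadowing property yields that every \<open>T\<close>-orbit is shadowed by an
  \<open>f\<close>-orbit.

  Expansivity of \<open>f\<close> makes the shadowing point unique as soon as \<open>2\<epsilon> \<le> c\<close>
  (\<open>shadows_orbit_unique\<close>), and the properties of the semiconjugacy rest on it. Call the
  shadowing point \<open>k x\<close>. As \<open>f (k x)\<close> shadows \<open>T x\<close>, it is \<open>k (T x)\<close>; so \<open>k\<close> is a semiconjugacy.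
  The relation ``\<open>z\<close> shadows \<open>x\<close>'' is closed, and relative compactness turns a function with closed
  graph and bounded displacement into a continuous one (\<open>shadowing_map_exists\<close>). Conversely, every
  semiconjugacy \<open>\<epsilon>\<close>-close to the identity consists of shadowing points, which gives uniqueness of
  \<open>k\<close>. When \<open>f\<close> and \<open>g\<close> commute, \<open>g (k x)\<close> shadows \<open>g x\<close> with an error controlled by the modulus of
  continuity of \<open>g\<close>, and so agrees with \<open>k (g x)\<close>. Finally, on fixed points of \<open>g\<close> the \<open>T\<close>-orbit is
  the \<open>h\<close>-orbit, so two fixed points with the same image under \<open>k\<close> have \<open>h\<close>-orbits within \<open>2\<epsilon>\<close> of
  each other, and expansivity of \<open>h\<close> identifies them.
\<close>

section \<open>Integer iterates\<close>

lemma int_iterate_0 [simp]: "int_iterate f 0 x = x"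
  by (simp add: int_iterate_def)

lemma int_iterate_Suc:
  assumes "bij f"
  shows "int_iterate f (n + 1) x = f (int_iterate f n x)"
proof (cases "n \<ge> 0")
  case True
  then have "nat (n + 1) = Suc (nat n)" by simp
  then show ?thesis using True by (simp add: int_iterate_def)
next
  case False
  then have *: "nat (- n) = Suc (nat (- (n + 1)))" by simp
  have "f (int_iterate f n x) = (inv f ^^ nat (- (n + 1))) x"
    using False unfolding int_iterate_def *
    by (simp add: surj_f_inv_f[OF bij_is_surj[OF assms]])
  then show ?thesis
    using False by (cases "n = -1") (simp_all add: int_iterate_def)
qed

text \<open>
  The source of the commutations below: the iterates of a map commute with whatever
  commutes with the map, and a semiconjugacy semiconjugates all iterates.
\<close>

lemma int_iterate_intertwine:
  assumes "bij a" "bij b" and intertwines: "\<And>x. u (a x) = b (u x)"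
  shows "u (int_iterate a n x) = int_iterate b n (u x)"
proof (induction n rule: int_induct[where k = 0])
  case base
  show ?case by simp
next
  case (step1 i)
  then show ?case by (simp add: int_iterate_Suc assms)
next
  case (step2 i)
  have "b (u (int_iterate a (i - 1) x)) = b (int_iterate b (i - 1) (u x))"
    using step2 int_iterate_Suc[OF assms(1), of "i - 1"] int_iterate_Suc[OF assms(2), of "i - 1"]
    by (simp flip: intertwines)
  then show ?case using assms(2) by (simp add: bij_is_inj inj_eq)
qed

lemma int_iterate_comp:
  assumes "bij g" "bij h" and commute: "\<And>x. g (h x) = h (g x)"
  shows "int_iterate (g \<circ> h) n x = int_iterate g n (int_iterate h n x)"
proof -
  have bij: "bij (g \<circ> h)" using assms by (simp add: bij_comp)
  have pull: "h (int_iterate g m y) = int_iterate g m (h y)" for m y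
    by (rule int_iterate_intertwine) (simp_all add: assms)
  have step: "(g \<circ> h) (int_iterate g m (int_iterate h m x))
      = int_iterate g (m + 1) (int_iterate h (m + 1) x)" for m
    by (simp add: int_iterate_Suc assms(1,2) pull)
  show ?thesis
  proof (induction n rule: int_induct[where k = 0])
    case base
    show ?case by simp
  next
    case (step1 i)
    then show ?case using step[of i] int_iterate_Suc[OF bij, of i x] by (simp del: o_apply)
  next
    case (step2 i)
    have "(g \<circ> h) (int_iterate (g \<circ> h) (i - 1) x)
        = (g \<circ> h) (int_iterate g (i - 1) (int_iterate h (i - 1) x))"
      using step2 step[of "i - 1"] int_iterate_Suc[OF bij, of "i - 1" x]
      by (simp del: o_apply)
    then show ?case using bij by (metis bij_is_inj injD)
  qed
qed

lemma int_iterate_fixed_point: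
  assumes "bij g" "g x = x"
  shows "int_iterate g n x = x"
  \<comment> \<open>a fixed point is a constant map intertwining \<open>g\<close> with the identity\<close>
  using int_iterate_intertwine[of g g "\<lambda>_. x" n x] assms by simp

lemma continuous_on_funpow:
  fixes f :: "'a::topological_space \<Rightarrow> 'a"
  assumes "continuous_on UNIV f"
  shows "continuous_on UNIV (f ^^ n)"
proof (induction n)
  case 0
  show ?case by (simp add: id_def)
next
  case (Suc n)
  then show ?case
    unfolding funpow.simps using assms
    by (intro continuous_on_compose) (auto intro: continuous_on_subset)
qed

lemma continuous_on_int_iterate:
  assumes "homeomorphism UNIV UNIV f (inv f)"
  shows "continuous_on UNIV (int_iterate f n)"
proof (cases "n \<ge> 0")
  case True
  then have "int_iterate f n = f ^^ nat n" by (auto simp: int_iterate_def)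
  then show ?thesis
    using assms continuous_on_funpow by (auto simp: homeomorphism_def)
next
  case False
  then have "int_iterate f n = inv f ^^ nat (- n)" by (auto simp: int_iterate_def)
  then show ?thesis
    using assms continuous_on_funpow by (auto simp: homeomorphism_def)
qed

section \<open>Uniform equivalences\<close>

lemma homeomorphism_UNIV_imp_bij:
  assumes "homeomorphism UNIV UNIV f (inv f)"
  shows "bij f"
  using assms unfolding homeomorphism_def by (metis UNIV_I bij_betw_byWitness subset_UNIV)

lemma uniform_equivalence_comp_homeomorphism:
  assumes "uniform_equivalence g" "uniform_equivalence h"
  shows "homeomorphism UNIV UNIV (g \<circ> h) (inv (g \<circ> h))"
proof -
  have bij: "bij g" "bij h" and cont: "continuous_on UNIV g" "continuous_on UNIV (inv g)"
    "continuous_on UNIV h" "continuous_on UNIV (inv h)"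
    using assms by (auto simp: uniform_equivalence_def uniformly_continuous_imp_continuous)
  have "homeomorphism UNIV UNIV f (inv f)"
    if "bij f" "continuous_on UNIV f" "continuous_on UNIV (inv f)" for f :: "'a \<Rightarrow> 'a"
    using that unfolding homeomorphism_def
    by (auto simp: bij_is_inj bij_is_surj surj_f_inv_f bij_imp_bij_inv)
  then have "homeomorphism UNIV UNIV g (inv g)" "homeomorphism UNIV UNIV h (inv h)"
    using bij cont by auto
  then have "homeomorphism UNIV UNIV (g \<circ> h) (inv h \<circ> inv g)"
    by (rule homeomorphism_compose[rotated])
  then show ?thesis using o_inv_distrib[OF bij] by simp
qed

lemma dist_less_if_dist_bar_less:
  assumes "dist_bar f f' < \<delta>" "\<delta> \<le> 1"
  shows "dist (f x) (f' x) < \<delta>"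
proof -
  have "bdd_above (range (\<lambda>x. min (dist (f x) (f' x)) 1))"
    by (rule bdd_aboveI[where M = 1]) auto
  then have "min (dist (f x) (f' x)) 1 \<le> dist_bar f f'"
    unfolding dist_bar_def by (rule cSUP_upper[rotated]) simp
  then show ?thesis using assms by (auto simp: min_def split: if_splits)
qed

section \<open>Shadowing one homeomorphism by another\<close>

definition shadows_orbit ::
    "('a::metric_space \<Rightarrow> 'a) \<Rightarrow> ('a \<Rightarrow> 'a) \<Rightarrow> real \<Rightarrow> 'a \<Rightarrow> 'a \<Rightarrow> bool" where
  "shadows_orbit f T \<epsilon> z x \<longleftrightarrow> (\<forall>n. dist (int_iterate f n z) (int_iterate T n x) \<le> \<epsilon>)"

lemma shadows_orbit_dist: "shadows_orbit f T \<epsilon> z x \<Longrightarrow> dist z x \<le> \<epsilon>"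
  by (metis shadows_orbit_def int_iterate_0)

lemma expansive_eqI:
  assumes "expansive_with f c"
    and "\<And>n. dist (int_iterate f n x) (int_iterate f n y) \<le> c"
  shows "x = y"
  using assms unfolding expansive_with_def by (meson not_less)

text \<open>
  The two errors may differ, because \<open>g (k x)\<close> and \<open>k (g x)\<close> shadow the same orbit with different
  precision.
\<close>

lemma shadows_orbit_unique:
  assumes "expansive_with f c" "shadows_orbit f T \<epsilon> z x" "shadows_orbit f T \<eta> z' x" "\<epsilon> + \<eta> \<le> c"
  shows "z = z'"
proof (rule expansive_eqI[OF assms(1)])
  fix n
  have "dist (int_iterate f n z) (int_iterate T n x) \<le> \<epsilon>"
    and "dist (int_iterate f n z') (int_iterate T n x) \<le> \<eta>"
    using assms(2,3) by (auto simp: shadows_orbit_def)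
  then show "dist (int_iterate f n z) (int_iterate f n z') \<le> c"
    using assms(4) dist_triangle2[of "int_iterate f n z" "int_iterate f n z'" "int_iterate T n x"]
    by linarith
qed

lemma shadows_orbit_image:
  assumes "bij f" "bij T" "shadows_orbit f T \<epsilon> z x"
  shows "shadows_orbit f T \<epsilon> (f z) (T x)"
  using assms unfolding shadows_orbit_def
  by (metis int_iterate_Suc int_iterate_intertwine)

lemma semiconjugacy_shadows_orbit:
  assumes "bij f" "bij T" "f \<circ> k = k \<circ> T" and close: "\<And>x. dist (k x) x \<le> \<epsilon>"
  shows "shadows_orbit f T \<epsilon> (k x) x"
proof -
  have "k (int_iterate T n x) = int_iterate f n (k x)" for n
    using assms(1-3) by (intro int_iterate_intertwine) (auto simp: fun_eq_iff)
  then show ?thesis unfolding shadows_orbit_def by (metis close)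
qed

text \<open>
  For each \<open>n\<close> the condition on the \<open>n\<close>-th iterates is closed, as they are continuous.
\<close>

lemma shadows_orbit_limit:
  assumes f: "homeomorphism UNIV UNIV f (inv f)" and T: "homeomorphism UNIV UNIV T (inv T)"
    and shadows: "\<And>j. shadows_orbit f T \<epsilon> (zs j) (xs j)"
    and zs: "zs \<longlonglongrightarrow> z" and xs: "xs \<longlonglongrightarrow> x"
  shows "shadows_orbit f T \<epsilon> z x"
  unfolding shadows_orbit_def
proof
  fix n
  have "(\<lambda>j. int_iterate f n (zs j)) \<longlonglongrightarrow> int_iterate f n z"
    using continuous_on_tendsto_compose[OF continuous_on_int_iterate[OF f] zs] by simp
  moreover have "(\<lambda>j. int_iterate T n (xs j)) \<longlonglongrightarrow> int_iterate T n x"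
    using continuous_on_tendsto_compose[OF continuous_on_int_iterate[OF T] xs] by simp
  ultimately have "(\<lambda>j. dist (int_iterate f n (zs j)) (int_iterate T n (xs j)))
      \<longlonglongrightarrow> dist (int_iterate f n z) (int_iterate T n x)"
    by (rule tendsto_dist)
  then show "dist (int_iterate f n z) (int_iterate T n x) \<le> \<epsilon>"
    by (rule LIMSEQ_le_const2) (use shadows in \<open>auto simp: shadows_orbit_def\<close>)
qed

text \<open>
  If the map failed to be continuous at \<open>x\<close>, some sequence \<open>xs \<longlonglongrightarrow> x\<close> would have images staying
  away from \<open>k x\<close>. These images are bounded, since \<open>k\<close> moves points by at most \<open>\<epsilon>\<close>, so a
  subsequence converges to a point that again shadows \<open>x\<close> and hence is \<open>k x\<close>.
\<close>

lemma shadowing_map_exists: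
  fixes f T :: "'a::metric_space \<Rightarrow> 'a"
  assumes rc: "relatively_compact_space TYPE('a)"
    and expansive: "expansive_with f c"
    and T: "homeomorphism UNIV UNIV T (inv T)"
    and "\<epsilon> + \<epsilon> \<le> c"
    and shadowed: "\<And>x. \<exists>z. shadows_orbit f T \<epsilon> z x"
  shows "\<exists>k. continuous_on UNIV k \<and> f \<circ> k = k \<circ> T \<and> (\<forall>x. shadows_orbit f T \<epsilon> (k x) x)"
proof -
  have f: "homeomorphism UNIV UNIV f (inv f)"
    using expansive by (simp add: expansive_with_def)
  have bij: "bij f" "bij T"
    using f T by (simp_all add: homeomorphism_UNIV_imp_bij)
  note unique = shadows_orbit_unique[OF expansive _ _ \<open>\<epsilon> + \<epsilon> \<le> c\<close>]
  obtain k where k: "\<And>x. shadows_orbit f T \<epsilon> (k x) x"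
    using shadowed by metis
  have "f (k x) = k (T x)" for x
    using unique[OF shadows_orbit_image[OF bij k] k] .
  moreover have "continuous_on UNIV k"
  proof (rule ccontr)
    assume "\<not> continuous_on UNIV k"
    then obtain x e where "e > 0"
      and *: "\<And>d. d > 0 \<Longrightarrow> \<exists>y. dist y x < d \<and> \<not> dist (k y) (k x) < e"
      unfolding continuous_on_iff by auto
    have "\<exists>y. dist y x < inverse (real (Suc j)) \<and> \<not> dist (k y) (k x) < e" for j
      by (rule *) simp
    then obtain xs where near: "\<And>j. dist (xs j) x < inverse (real (Suc j))"
      and away: "\<And>j. \<not> dist (k (xs j)) (k x) < e"
      by metis
    have "(\<lambda>j. dist (xs j) x) \<longlonglongrightarrow> 0"
      by (rule tendsto_sandwich[OF _ _ tendsto_const LIMSEQ_inverse_real_of_nat])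
         (use near in \<open>auto intro!: always_eventually less_imp_le simp del: of_nat_Suc\<close>)
    then have xs: "xs \<longlonglongrightarrow> x" by (rule tendsto_dist_iff[THEN iffD2])
    have "dist x (k (xs j)) \<le> 1 + \<epsilon>" for j
    proof -
      have "inverse (real (Suc j)) \<le> 1" by (simp add: field_simps)
      then have "dist (xs j) x \<le> 1" using near[of j] by linarith
      then show ?thesis
        using shadows_orbit_dist[OF k, of "xs j"] dist_triangle3[of x "k (xs j)" "xs j"]
        by (simp add: dist_commute)
    qed
    then have "bounded (range (\<lambda>j. k (xs j)))"
      unfolding bounded_def by blast
    then have "\<exists>C. compact C \<and> range (\<lambda>j. k (xs j)) \<subseteq> C"
      by (rule rc[unfolded relatively_compact_space_def, rule_format])
    then obtain C where "compact C" and C: "range (\<lambda>j. k (xs j)) \<subseteq> C"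
      by (elim exE conjE)
    have "\<forall>j. k (xs j) \<in> C" using C by (simp add: image_subset_iff)
    with compact_imp_seq_compact[OF \<open>compact C\<close>]
    obtain z r where r: "strict_mono r" and z: "((\<lambda>j. k (xs j)) \<circ> r) \<longlonglongrightarrow> z"
      by (rule seq_compactE)
    from z have z: "(\<lambda>j. k (xs (r j))) \<longlonglongrightarrow> z" by (simp only: o_def)
    have "shadows_orbit f T \<epsilon> z x"
      using LIMSEQ_subseq_LIMSEQ[OF xs r] k
      by (intro shadows_orbit_limit[OF f T _ z, of \<epsilon> "xs \<circ> r"]) simp_all
    then have "z = k x" using k by (rule unique)
    with z have "(\<lambda>j. k (xs (r j))) \<longlonglongrightarrow> k x" by simp
    then have "(\<lambda>j. dist (k (xs (r j))) (k x)) \<longlonglongrightarrow> 0" by (rule tendsto_dist_iff[THEN iffD1])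
    then have "eventually (\<lambda>j. dist (k (xs (r j))) (k x) < e) sequentially"
      using \<open>e > 0\<close> by (rule order_tendstoD(2))
    then show False using away by simp
  qed
  ultimately show ?thesis using k by (auto simp: fun_eq_iff)
qed

section \<open>From paired tracing to shadowing\<close>

text \<open>
  The sequence \<open>n \<mapsto> h\<^sup>n x\<close> is the paired pseudo orbit to trace: its defect at \<open>n\<close> is the distance
  from \<open>f y\<close> to \<open>g (h y)\<close> at \<open>y = h\<^sup>n x\<close>.
\<close>

lemma paired_shadowing_imp_shadows_orbit:
  fixes f g :: "'a::metric_space \<Rightarrow> 'a"
  assumes "paired_shadowing_property f g" "\<epsilon> > 0"
  shows "\<exists>\<delta>>0. \<forall>h\<in>UE \<delta> f g. \<forall>x. \<exists>z. shadows_orbit f (g \<circ> h) \<epsilon> z x"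
proof -
  obtain \<delta> where "\<delta> > 0" and
    traced: "\<And>xs. paired_pseudo_orbit f g \<delta> xs \<Longrightarrow> \<exists>x. paired_traced f g \<epsilon> xs x"
    using assms unfolding paired_shadowing_property_def by blast
  have "\<exists>z. shadows_orbit f (g \<circ> h) \<epsilon> z x" if h: "h \<in> UE (min \<delta> 1) f g" for h x
  proof -
    have bij: "bij g" "bij h" and commute: "\<And>y. g (h y) = h (g y)"
      using h by (auto simp: UE_def commutative_paired_system_def paired_system_def
          uniform_equivalence_def fun_eq_iff)
    have "dist (f y) ((g \<circ> h) y) < min \<delta> 1" for y
      \<comment> \<open>below the truncation level \<open>1\<close>, the truncated distance is the true one\<close>
      using h by (intro dist_less_if_dist_bar_less[of f "g \<circ> h"]) (auto simp: UE_def)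
    then have "dist (f y) (g (h y)) \<le> \<delta>" for y
      by (simp add: less_imp_le)
    then have "paired_pseudo_orbit f g \<delta> (\<lambda>n. int_iterate h n x)"
      unfolding paired_pseudo_orbit_def by (simp add: int_iterate_Suc bij)
    then obtain z where "paired_traced f g \<epsilon> (\<lambda>n. int_iterate h n x) z"
      using traced by blast
    then show ?thesis
      unfolding paired_traced_def shadows_orbit_def int_iterate_comp[OF bij commute] by blast
  qed
  then show ?thesis using \<open>\<delta> > 0\<close> by (intro exI[of _ "min \<delta> 1"]) auto
qed

lemma paired_shadowing_map_exists:
  fixes f g :: "'a::metric_space \<Rightarrow> 'a"
  assumes rc: "relatively_compact_space TYPE('a)"
    and psp: "paired_shadowing_property f g"
    and expansive: "expansive_with f c"
    and "\<epsilon> > 0" "\<epsilon> + \<epsilon> \<le> c"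
  shows "\<exists>\<delta>>0. \<forall>h\<in>UE \<delta> f g. \<exists>k. continuous_on UNIV k \<and> f \<circ> k = k \<circ> g \<circ> h \<and>
    (\<forall>x. shadows_orbit f (g \<circ> h) \<epsilon> (k x) x)"
proof -
  obtain \<delta> where "\<delta> > 0"
    and shadowed: "\<And>h x. h \<in> UE \<delta> f g \<Longrightarrow> \<exists>z. shadows_orbit f (g \<circ> h) \<epsilon> z x"
    using paired_shadowing_imp_shadows_orbit[OF psp \<open>\<epsilon> > 0\<close>] by blast
  have "\<exists>k. continuous_on UNIV k \<and> f \<circ> k = k \<circ> g \<circ> h \<and> (\<forall>x. shadows_orbit f (g \<circ> h) \<epsilon> (k x) x)"
    if h: "h \<in> UE \<delta> f g" for h
  proof -
    have "homeomorphism UNIV UNIV (g \<circ> h) (inv (g \<circ> h))"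
      using h by (intro uniform_equivalence_comp_homeomorphism)
        (auto simp: UE_def commutative_paired_system_def paired_system_def)
    from shadowing_map_exists[OF rc expansive this \<open>\<epsilon> + \<epsilon> \<le> c\<close> shadowed[OF h]]
    show ?thesis by (simp add: o_assoc)
  qed
  then show ?thesis using \<open>\<delta> > 0\<close> by blast
qed

section \<open>Stability\<close>

lemma paired_topologically_stableI:
  fixes f g :: "'a::metric_space \<Rightarrow> 'a"
  assumes rc: "relatively_compact_space TYPE('a)"
    and psp: "paired_shadowing_property f g"
    and expansive: "expansive_with f c"
  shows "paired_topologically_stable f g"
  unfolding paired_topologically_stable_def
proof (intro allI impI)
  fix \<epsilon> :: real
  assume "\<epsilon> > 0"
  have "c > 0" using expansive by (simp add: expansive_with_def)
  \<comment> \<open>halving \<open>\<epsilon>\<close> gives the strict inequality that stability demands, halving \<open>c\<close> gives uniqueness\<close>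
  define \<eta> where "\<eta> = min (\<epsilon> / 2) (c / 2)"
  have \<eta>: "\<eta> > 0" "\<eta> + \<eta> \<le> c" "\<eta> < \<epsilon>"
    using \<open>c > 0\<close> \<open>\<epsilon> > 0\<close> by (auto simp: \<eta>_def min_def)
  obtain \<delta> where "\<delta> > 0" and exists: "\<And>h. h \<in> UE \<delta> f g \<Longrightarrow> \<exists>k. continuous_on UNIV k \<and>
      f \<circ> k = k \<circ> g \<circ> h \<and> (\<forall>x. shadows_orbit f (g \<circ> h) \<eta> (k x) x)"
    using paired_shadowing_map_exists[OF rc psp expansive \<eta>(1,2)] by blast
  have "\<exists>k. continuous_on UNIV k \<and> f \<circ> k = k \<circ> g \<circ> h \<and> (\<forall>x. dist (k x) x < \<epsilon>)"
    if h: "h \<in> UE \<delta> f g" for h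
  proof -
    obtain k where k: "continuous_on UNIV k" "f \<circ> k = k \<circ> g \<circ> h"
      and shadows: "\<And>x. shadows_orbit f (g \<circ> h) \<eta> (k x) x"
      using exists[OF h] by blast
    have "dist (k x) x < \<epsilon>" for x
      using shadows_orbit_dist[OF shadows, of x] \<eta>(3) by linarith
    then show ?thesis using k by blast
  qed
  then show "\<exists>\<delta>>0. \<forall>h\<in>UE \<delta> f g. \<exists>k. continuous_on UNIV k \<and> f \<circ> k = k \<circ> g \<circ> h \<and>
      (\<forall>x. dist (k x) x < \<epsilon>)"
    using \<open>\<delta> > 0\<close> by blast
qed

text \<open>
  The map \<open>k\<close> is constructed with a precision \<open>\<eta>\<close> so fine that \<open>g\<close> maps \<open>\<eta>\<close>-close points to
  \<open>c/2\<close>-close ones. Since \<open>g\<close> commutes with all iterates of \<open>f\<close> and of \<open>g \<circ> h\<close>, the point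
  \<open>g (k x)\<close> then shadows \<open>g x\<close> within \<open>c/2\<close>, which together with \<open>\<eta> \<le> c/2\<close> is within the reach of
  uniqueness.
\<close>

lemma c_paired_topologically_stableI:
  fixes f g :: "'a::metric_space \<Rightarrow> 'a"
  assumes rc: "relatively_compact_space TYPE('a)"
    and psp: "paired_shadowing_property f g"
    and expansive: "expansive_with f c"
    and comm: "commutative_paired_system f g"
  shows "c_paired_topologically_stable f g"
  unfolding c_paired_topologically_stable_def
proof (intro allI impI)
  fix \<epsilon> :: real
  assume "\<epsilon> > 0"
  have "c > 0" using expansive by (simp add: expansive_with_def)
  have bij: "bij f" "bij g" and "uniformly_continuous_on UNIV g"
    and fg: "\<And>x. g (f x) = f (g x)"
    using comm by (auto simp: commutative_paired_system_def paired_system_def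
        uniform_equivalence_def fun_eq_iff)
  then obtain d where "d > 0" and d: "\<And>x y. dist x y < d \<Longrightarrow> dist (g x) (g y) < c / 2"
    unfolding uniformly_continuous_on_def using \<open>c > 0\<close> by (metis UNIV_I half_gt_zero)
  define \<eta> where "\<eta> = min (min (\<epsilon> / 2) (c / 2)) (d / 2)"
  have \<eta>: "\<eta> > 0" "\<eta> + \<eta> \<le> c" "\<eta> < \<epsilon>" "\<eta> < d" "c / 2 + \<eta> \<le> c"
    using \<open>c > 0\<close> \<open>\<epsilon> > 0\<close> \<open>d > 0\<close> by (auto simp: \<eta>_def min_def)
  obtain \<delta> where "\<delta> > 0" and exists: "\<And>h. h \<in> UE \<delta> f g \<Longrightarrow> \<exists>k. continuous_on UNIV k \<and>
      f \<circ> k = k \<circ> g \<circ> h \<and> (\<forall>x. shadows_orbit f (g \<circ> h) \<eta> (k x) x)"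
    using paired_shadowing_map_exists[OF rc psp expansive \<eta>(1,2)] by blast
  have "\<exists>k. continuous_on UNIV k \<and> f \<circ> k = k \<circ> g \<circ> h \<and> (\<forall>x. dist (k x) x < \<epsilon>) \<and> g \<circ> k = k \<circ> g"
    if h: "h \<in> UE \<delta> f g" for h
  proof -
    have "bij h" and gh: "\<And>y. h (g y) = g (h y)"
      using h by (auto simp: UE_def commutative_paired_system_def paired_system_def
          uniform_equivalence_def fun_eq_iff)
    then have bijT: "bij (g \<circ> h)" using bij by (simp add: bij_comp)
    obtain k where k: "continuous_on UNIV k" "f \<circ> k = k \<circ> g \<circ> h"
      and shadows: "\<And>x. shadows_orbit f (g \<circ> h) \<eta> (k x) x"
      using exists[OF h] by blast
    have "g (k x) = k (g x)" for x
    proof (rule shadows_orbit_unique[OF expansive _ shadows \<eta>(5)])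
      show "shadows_orbit f (g \<circ> h) (c / 2) (g (k x)) (g x)"
        unfolding shadows_orbit_def
      proof
        fix n
        have "g (int_iterate f n (k x)) = int_iterate f n (g (k x))"
          by (rule int_iterate_intertwine) (simp_all add: bij fg)
        moreover have "g (int_iterate (g \<circ> h) n x) = int_iterate (g \<circ> h) n (g x)"
          by (rule int_iterate_intertwine[OF bijT bijT]) (simp add: gh)
        moreover have "dist (int_iterate f n (k x)) (int_iterate (g \<circ> h) n x) < d"
          using shadows[of x] \<eta>(4) unfolding shadows_orbit_def by (meson le_less_trans)
        ultimately show "dist (int_iterate f n (g (k x))) (int_iterate (g \<circ> h) n (g x)) \<le> c / 2"
          by (metis d less_imp_le)
      qed
    qed
    then have "g \<circ> k = k \<circ> g" by (simp add: fun_eq_iff)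
    moreover have "dist (k x) x < \<epsilon>" for x
      using shadows_orbit_dist[OF shadows, of x] \<eta>(3) by linarith
    ultimately show ?thesis using k by blast
  qed
  then show "\<exists>\<delta>>0. \<forall>h\<in>UE \<delta> f g. \<exists>k. continuous_on UNIV k \<and> f \<circ> k = k \<circ> g \<circ> h \<and>
      (\<forall>x. dist (k x) x < \<epsilon>) \<and> g \<circ> k = k \<circ> g"
    using \<open>\<delta> > 0\<close> by blast
qed

text \<open>
  Along a fixed point of \<open>g\<close> the orbits of \<open>g \<circ> h\<close> and \<open>h\<close> coincide, so \<open>k x = k y\<close> forces the
  \<open>h\<close>-orbits of \<open>x\<close> and \<open>y\<close> to stay within \<open>2\<epsilon>\<close> of each other.
\<close>

lemma shadowing_map_inj_on_Fix:
  assumes "bij g" "bij h" and commute: "\<And>x. g (h x) = h (g x)"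
    and expansive: "expansive_with h c'" and "\<epsilon> + \<epsilon> \<le> c'"
    and shadows: "\<And>x. shadows_orbit f (g \<circ> h) \<epsilon> (k x) x"
  shows "inj_on k {x. g x = x}"
proof (rule inj_onI)
  fix x y
  assume xy: "x \<in> {x. g x = x}" "y \<in> {x. g x = x}" and "k x = k y"
  have orbit: "int_iterate (g \<circ> h) n w = int_iterate h n w" if "g w = w" for n w
  proof -
    have "g (int_iterate h n w) = int_iterate h n (g w)"
      by (rule int_iterate_intertwine[where u = g and a = h and b = h])
         (simp_all add: assms(2) commute)
    then have "int_iterate g n (int_iterate h n w) = int_iterate h n w"
      using that by (intro int_iterate_fixed_point[OF assms(1)]) simp
    then show ?thesis unfolding int_iterate_comp[OF assms(1-3)] .
  qed
  show "x = y"
  proof (rule expansive_eqI[OF expansive])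
    fix n
    have "dist (int_iterate f n (k x)) (int_iterate h n x) \<le> \<epsilon>"
      and "dist (int_iterate f n (k x)) (int_iterate h n y) \<le> \<epsilon>"
      using shadows[of x] shadows[of y] xy \<open>k x = k y\<close> by (auto simp: shadows_orbit_def orbit)
    then show "dist (int_iterate h n x) (int_iterate h n y) \<le> c'"
      using \<open>\<epsilon> + \<epsilon> \<le> c'\<close>
        dist_triangle3[of "int_iterate h n x" "int_iterate h n y" "int_iterate f n (k x)"]
      by linarith
  qed
qed

theorem theorem3p5:
  fixes f g :: "'a::metric_space \<Rightarrow> 'a" and c :: real
  assumes "relatively_compact_space TYPE('a)"
    and "paired_system f g"
    and "paired_shadowing_property f g"
    and "expansive_with f c"
  shows "paired_topologically_stable f g \<and>
    (commutative_paired_system f g \<longrightarrow> c_paired_topologically_stable f g) \<and>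
    (\<forall>\<epsilon>. 0 < \<epsilon> \<and> \<epsilon> < c / 3 \<longrightarrow>
      (\<exists>\<delta>>0. \<forall>h \<in> UE \<delta> f g.
        (\<exists>!k. continuous_on UNIV k \<and> f \<circ> k = k \<circ> g \<circ> h \<and> (\<forall>x. dist (k x) x \<le> \<epsilon>)) \<and>
        (\<forall>c' k. expansive_with h c' \<and> c' \<ge> 3 * \<epsilon> \<and>
            continuous_on UNIV k \<and> f \<circ> k = k \<circ> g \<circ> h \<and> (\<forall>x. dist (k x) x \<le> \<epsilon>) \<longrightarrow>
          inj_on k {x. g x = x})))"
proof (intro conjI impI allI)
  show "paired_topologically_stable f g"
    using assms(1,3,4) by (rule paired_topologically_stableI)
  show "c_paired_topologically_stable f g" if "commutative_paired_system f g"
    using assms(1,3,4) that by (rule c_paired_topologically_stableI)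
next
  fix \<epsilon> :: real
  assume "0 < \<epsilon> \<and> \<epsilon> < c / 3"
  then have \<epsilon>: "\<epsilon> > 0" "\<epsilon> + \<epsilon> \<le> c" by auto
  obtain \<delta> where "\<delta> > 0" and exists: "\<And>h. h \<in> UE \<delta> f g \<Longrightarrow> \<exists>k. continuous_on UNIV k \<and>
      f \<circ> k = k \<circ> g \<circ> h \<and> (\<forall>x. shadows_orbit f (g \<circ> h) \<epsilon> (k x) x)"
    using paired_shadowing_map_exists[OF assms(1,3,4) \<epsilon>] by blast
  have "(\<exists>!k. continuous_on UNIV k \<and> f \<circ> k = k \<circ> g \<circ> h \<and> (\<forall>x. dist (k x) x \<le> \<epsilon>)) \<and>
        (\<forall>c' k. expansive_with h c' \<and> c' \<ge> 3 * \<epsilon> \<and>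
            continuous_on UNIV k \<and> f \<circ> k = k \<circ> g \<circ> h \<and> (\<forall>x. dist (k x) x \<le> \<epsilon>) \<longrightarrow>
          inj_on k {x. g x = x})"
    if h: "h \<in> UE \<delta> f g" for h
  proof -
    have bij: "bij f" "bij g" "bij h" and commute: "\<And>y. g (h y) = h (g y)"
      using h assms(2) by (auto simp: UE_def commutative_paired_system_def paired_system_def
          uniform_equivalence_def fun_eq_iff)
    have shadows: "shadows_orbit f (g \<circ> h) \<epsilon> (k x) x"
      if "f \<circ> k = k \<circ> g \<circ> h" "\<forall>x. dist (k x) x \<le> \<epsilon>" for k x
      using that by (intro semiconjugacy_shadows_orbit[OF bij(1) bij_comp[OF bij(3,2)]])
        (simp_all only: o_assoc)
    obtain k where k: "continuous_on UNIV k" "f \<circ> k = k \<circ> g \<circ> h"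
      and "\<And>x. shadows_orbit f (g \<circ> h) \<epsilon> (k x) x"
      using exists[OF h] by blast
    then have close: "\<forall>x. dist (k x) x \<le> \<epsilon>" by (intro allI shadows_orbit_dist)
    have unique: "k' = k" if "f \<circ> k' = k' \<circ> g \<circ> h" "\<forall>x. dist (k' x) x \<le> \<epsilon>" for k'
      using shadows_orbit_unique[OF assms(4) shadows[OF that] shadows[OF k(2) close] \<epsilon>(2)]
      by (rule ext)
    have "\<exists>!k. continuous_on UNIV k \<and> f \<circ> k = k \<circ> g \<circ> h \<and> (\<forall>x. dist (k x) x \<le> \<epsilon>)"
    proof (rule ex1I[of _ k])
      show "continuous_on UNIV k \<and> f \<circ> k = k \<circ> g \<circ> h \<and> (\<forall>x. dist (k x) x \<le> \<epsilon>)"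
        by (intro conjI k close)
    qed (elim conjE, rule unique)
    moreover have "inj_on k' {x. g x = x}"
      if "expansive_with h c'" "c' \<ge> 3 * \<epsilon>" "f \<circ> k' = k' \<circ> g \<circ> h" "\<forall>x. dist (k' x) x \<le> \<epsilon>" for c' k'
      using that(2) \<epsilon>(1)
      by (intro shadowing_map_inj_on_Fix[OF bij(2,3) commute that(1) _ shadows[OF that(3,4)]]) auto
    ultimately show ?thesis by blast
  qed
  then show "\<exists>\<delta>>0. \<forall>h \<in> UE \<delta> f g.
        (\<exists>!k. continuous_on UNIV k \<and> f \<circ> k = k \<circ> g \<circ> h \<and> (\<forall>x. dist (k x) x \<le> \<epsilon>)) \<and>
        (\<forall>c' k. expansive_with h c' \<and> c' \<ge> 3 * \<epsilon> \<and>
            continuous_on UNIV k \<and> f \<circ> k = k \<circ> g \<circ> h \<and> (\<forall>x. dist (k x) x \<le> \<epsilon>) \<longrightarrow>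
          inj_on k {x. g x = x})"
    using \<open>\<delta> > 0\<close> by blast
qed

end
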